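(* Let $d\ge2$, let $\mathcal{A}\subseteq\mathbb{R}^m$ be open, and suppose that $(\alpha,x)\mapsto\varphi_\alpha(x)\in\mathbb{R}$ is jointly $C^2$ on $\mathcal{A}\times\mathbb{R}^d$. Fix a tuple $\boldsymbol{\alpha}^0=(\alpha_1^0,\ldots,\alpha_d^0)\in\mathcal{A}^d$, and suppose that there exists an open neighbourhood $\boldsymbol{\alpha}^0\in\mathcal{V}\subseteq\mathcal{A}^d$ such that, for every $\boldsymbol{\beta}\in\mathcal{V}$, the encoding map $\mathsf{H}_{\boldsymbol{\beta}}$ is fold non-degenerate at all of its critical points in $\mathbb{R}^d$. Then there exist open neighbourhoods $\alpha_j^0\in U_j\subseteq\mathcal{A}$, $j=1,\ldots,d$, depending only on $\boldsymbol{\alpha}^0$ and $\mathcal{V}$, such that for every Borel $1$-rectifiable set $E\subseteq\mathbb{R}^d$ satisfying $\mathcal{H}^1(E)>0$ there exists an index $j_E\in\{1,\ldots,d\}$ (which may depend on $E$) for which $$\mathcal{H}^1\big(\varphi_\alpha(E)\big)>0\qquad\text{for every }\alpha\in U_{j_E}.$$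
   Context: $\mathcal{H}^1$ is $1$-dimensional Hausdorff measure. A Borel set $E\subseteq\mathbb{R}^d$ is $1$-rectifiable if there are Lipschitz maps $f_j:\mathbb{R}\to\mathbb{R}^d$, $j\in\mathbb{N}$, with $\mathcal{H}^1(E\setminus\bigcup_j f_j(\mathbb{R}))=0$. For $\boldsymbol{\beta}=(\beta_1,\ldots,\beta_d)\in\mathcal{A}^d$ the encoding map is $\mathsf{H}_{\boldsymbol{\beta}}(x)=(\varphi_{\beta_1}(x),\ldots,\varphi_{\beta_d}(x))$, with spatial derivative $D_x\mathsf{H}_{\boldsymbol{\beta}}(x)$; $J_{\boldsymbol{\beta}}(x)=\det D_x\mathsf{H}_{\boldsymbol{\beta}}(x)$; critical points are the points of $\Sigma_{\boldsymbol{\beta}}=\{x\in\mathbb{R}^d:\operatorname{rank}D_x\mathsf{H}_{\boldsymbol{\beta}}(x)\leq d-1\}$. The map $\mathsf{H}_{\boldsymbol{\beta}}$ is fold non-degenerate at a critical point $x$ if $\operatorname{rank}D_x\mathsf{H}_{\boldsymbol{\beta}}(x)=d-1$ and $D_xJ_{\boldsymbol{\beta}}(x)[v]\neq0$ for every $v\in\ker D_x\mathsf{H}_{\boldsymbol{\beta}}(x)\setminus\{0\}$. *)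

theory Defs
  imports "HOL-Analysis.Analysis"
begin

text \<open>
  The one-dimensional Hausdorff (outer) measure, defined on arbitrary subsets of a metric space.
  Covering sets are required to be bounded because \<^const>\<open>diameter\<close> is an unspecified real
  number on unbounded sets; empty covering sets have diameter 0, so finite covers are included.
\<close>

definition hausdorff_1_delta :: "real \<Rightarrow> 'a::metric_space set \<Rightarrow> ennreal" where
  "hausdorff_1_delta \<delta> E =
     (INF C \<in> {C :: nat \<Rightarrow> 'a set. E \<subseteq> (\<Union>i. C i) \<and> (\<forall>i. bounded (C i) \<and> diameter (C i) \<le> \<delta>)}.
        \<Sum>i. ennreal (diameter (C i)))"

definition hausdorff_1 :: "'a::metric_space set \<Rightarrow> ennreal" where
  "hausdorff_1 E = (SUP \<delta> \<in> {0<..}. hausdorff_1_delta \<delta> E)"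

definition rectifiable_1 :: "'a::metric_space set \<Rightarrow> bool" where
  "rectifiable_1 E \<longleftrightarrow>
     E \<in> sets borel \<and>
     (\<exists>f :: nat \<Rightarrow> real \<Rightarrow> 'a.
        (\<forall>j. \<exists>L. L-lipschitz_on UNIV (f j)) \<and> hausdorff_1 (E - (\<Union>j. range (f j))) = 0)"

text \<open>Meaningful for open \<open>S\<close>: first and second derivatives exist at every point of \<open>S\<close>, and the
  second derivative is continuous in operator norm.\<close>

definition C2_on :: "'a::real_normed_vector set \<Rightarrow> ('a \<Rightarrow> 'b::real_normed_vector) \<Rightarrow> bool" where
  "C2_on S f \<longleftrightarrow>
     (\<exists>(f' :: 'a \<Rightarrow> 'a \<Rightarrow>\<^sub>L 'b) (f'' :: 'a \<Rightarrow> 'a \<Rightarrow>\<^sub>L 'a \<Rightarrow>\<^sub>L 'b).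
        (\<forall>z\<in>S. (f has_derivative blinfun_apply (f' z)) (at z)) \<and>
        (\<forall>z\<in>S. (f' has_derivative blinfun_apply (f'' z)) (at z)) \<and>
        continuous_on S f'')"

definition encoding_map ::
    "(real^'m \<Rightarrow> real^'d \<Rightarrow> real) \<Rightarrow> (real^'m)^'d \<Rightarrow> real^'d \<Rightarrow> real^'d" where
  "encoding_map \<phi> \<beta> x = (\<chi> j. \<phi> (\<beta> $ j) x)"

definition derivative_matrix :: "(real^'d \<Rightarrow> real^'d) \<Rightarrow> real^'d \<Rightarrow> real^'d^'d" where
  "derivative_matrix H x = matrix (frechet_derivative H (at x))"

definition jacobian_det :: "(real^'d \<Rightarrow> real^'d) \<Rightarrow> real^'d \<Rightarrow> real" where
  "jacobian_det H x = det (derivative_matrix H x)"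

definition critical_points :: "(real^'d \<Rightarrow> real^'d) \<Rightarrow> (real^'d) set" where
  "critical_points H = {x. rank (derivative_matrix H x) \<le> CARD('d) - 1}"

definition fold_nondegenerate_at :: "(real^'d \<Rightarrow> real^'d) \<Rightarrow> real^'d \<Rightarrow> bool" where
  "fold_nondegenerate_at H x \<longleftrightarrow>
     rank (derivative_matrix H x) = CARD('d) - 1 \<and>
     (\<forall>v. derivative_matrix H x *v v = 0 \<and> v \<noteq> 0 \<longrightarrow>
          frechet_derivative (jacobian_det H) (at x) v \<noteq> 0)"

end

theory Submission
  imports Defs
begin

text \<open>
  Choose the \<open>U j\<close> with product inside \<open>V\<close>. If the conclusion fails for \<open>E\<close>, some \<open>\<beta> \<in> V\<close> makes every
  coordinate of \<open>H = encoding_map \<phi> \<beta>\<close> map \<open>E\<close> to a null set, and it remains to see that \<open>E\<close> is null.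

  A Lipschitz curve all of whose coordinates map \<open>S\<close> to a null set is null on \<open>S\<close>: if \<open>U\<close> is open with
  \<open>S \<subseteq> U\<close> and \<open>U - S\<close> of small measure, then on each component \<open>I\<close> of \<open>U\<close> the image of a coordinate is
  an interval of length at most a constant times the measure of \<open>I - S\<close>. No differentiability of
  Lipschitz functions is needed. Applied to \<open>H \<circ> f\<close>, it gives that \<open>H\<close> maps the pieces of \<open>E\<close> to null
  sets.

  To pull this back to \<open>E\<close>, note that \<open>H\<close> is locally expanding near regular points. At a fold point the
  pair \<open>(H, jacobian_det H)\<close> has injective derivative, hence is locally expanding, and its second
  component vanishes on the critical set; so \<open>H\<close> is locally expanding along the critical set as well.
\<close>

subsection \<open>Null sets of the Hausdorff measure\<close>

text \<open>For null sets the bound on the size of covering sets comes for free: if the diameters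
  sum to at most \<open>min \<delta> e\<close>, then each single diameter is at most
  \<open>\<delta>\<close>. Later arguments only have to control the total of the diameters.\<close>

lemma hausdorff_1_eq_0_iff:
  fixes E :: "'a::metric_space set"
  shows "hausdorff_1 E = 0 \<longleftrightarrow>
    (\<forall>\<epsilon>>0. \<exists>C. E \<subseteq> (\<Union>i::nat. C i) \<and> (\<forall>i. bounded (C i)) \<and>
       (\<Sum>i. ennreal (diameter (C i))) \<le> ennreal \<epsilon>)"
    (is "_ \<longleftrightarrow> ?R")
proof
  assume H: "hausdorff_1 E = 0"
  show ?R
  proof (intro allI impI)
    fix \<epsilon> :: real assume "\<epsilon> > 0"
    have "hausdorff_1_delta 1 E \<le> hausdorff_1 E"
      unfolding hausdorff_1_def by (rule SUP_upper) simp
    with H \<open>\<epsilon> > 0\<close> have "hausdorff_1_delta 1 E < ennreal \<epsilon>" by simp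
    then show "\<exists>C. E \<subseteq> (\<Union>i::nat. C i) \<and> (\<forall>i. bounded (C i)) \<and>
       (\<Sum>i. ennreal (diameter (C i))) \<le> ennreal \<epsilon>"
      unfolding hausdorff_1_delta_def INF_less_iff by (auto intro: less_imp_le)
  qed
next
  assume R: ?R
  have "hausdorff_1_delta \<delta> E \<le> 0" if "\<delta> > 0" for \<delta>
  proof (rule ennreal_le_epsilon)
    fix e :: real assume "e > 0"
    define \<epsilon> where "\<epsilon> = min \<delta> e"
    have "\<epsilon> > 0" using \<open>e > 0\<close> that by (simp add: \<epsilon>_def)
    then obtain C :: "nat \<Rightarrow> 'a set" where C: "E \<subseteq> (\<Union>i. C i)" "\<And>i. bounded (C i)"
      and le: "(\<Sum>i. ennreal (diameter (C i))) \<le> ennreal \<epsilon>"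
      using R by blast
    have "diameter (C i) \<le> \<delta>" for i
    proof -
      have "ennreal (diameter (C i)) \<le> (\<Sum>i. ennreal (diameter (C i)))"
        using sum_le_suminf[of "\<lambda>i. ennreal (diameter (C i))" "{i}"] by simp
      also note le
      finally show ?thesis
        using \<open>\<epsilon> > 0\<close> by (simp add: \<epsilon>_def ennreal_le_iff)
    qed
    then have "hausdorff_1_delta \<delta> E \<le> (\<Sum>i. ennreal (diameter (C i)))"
      unfolding hausdorff_1_delta_def using C by (intro INF_lower) auto
    also note le
    also have "ennreal \<epsilon> \<le> 0 + ennreal e"
      by (simp add: \<epsilon>_def ennreal_leI)
    finally show "hausdorff_1_delta \<delta> E \<le> 0 + ennreal e" .
  qed
  then show "hausdorff_1 E = 0"
    unfolding hausdorff_1_def by (simp add: SUP_eq_iff le_zero_eq[symmetric] SUP_le_iff del: le_zero_eq)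
qed

section \<open>Stability of null sets under countable unions, localisation and expanding
  maps\<close>

lemma hausdorff_1_mono_null: "hausdorff_1 F = 0 \<Longrightarrow> E \<subseteq> F \<Longrightarrow> hausdorff_1 E = 0"
  unfolding hausdorff_1_eq_0_iff by (meson subset_trans)

lemma hausdorff_1_UN_null:
  fixes E :: "nat \<Rightarrow> 'a::metric_space set"
  assumes "\<And>n. hausdorff_1 (E n) = 0"
  shows "hausdorff_1 (\<Union>n. E n) = 0"
  unfolding hausdorff_1_eq_0_iff
proof (intro allI impI)
  fix \<epsilon> :: real assume "\<epsilon> > 0"
  have "\<exists>C. E n \<subseteq> (\<Union>i::nat. C i) \<and> (\<forall>i. bounded (C i)) \<and>
       (\<Sum>i. ennreal (diameter (C i))) \<le> ennreal (\<epsilon> * (1/2)^Suc n)" for n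
    using assms[of n] \<open>\<epsilon> > 0\<close> unfolding hausdorff_1_eq_0_iff by simp
  then obtain C where C: "\<And>n. E n \<subseteq> (\<Union>i::nat. C n i)" "\<And>n i. bounded (C n i)"
    and le: "\<And>n. (\<Sum>i. ennreal (diameter (C n i))) \<le> ennreal (\<epsilon> * (1/2)^Suc n)"
    by metis
  define D where "D k = (case prod_decode k of (n, i) \<Rightarrow> C n i)" for k
  have "(\<Sum>k. ennreal (diameter (D k))) =
      (\<Sum>k. (\<lambda>(n, i). ennreal (diameter (C n i))) (prod_decode k))"
    by (intro suminf_cong) (simp add: D_def split: prod.split)
  also have "\<dots> = (\<Sum>n. \<Sum>i. ennreal (diameter (C n i)))"
    by (rule suminf_ennreal_2dimen) simp
  also have "\<dots> \<le> (\<Sum>n. ennreal (\<epsilon> * (1/2)^Suc n))"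
    by (intro suminf_le le) auto
  also have "\<dots> = ennreal \<epsilon>"
    using sums_mult[OF power_half_series, of \<epsilon>] \<open>\<epsilon> > 0\<close>
    by (intro suminf_ennreal_eq) auto
  finally have *: "(\<Sum>k. ennreal (diameter (D k))) \<le> ennreal \<epsilon>" .
  have "(\<Union>n. E n) \<subseteq> (\<Union>k. D k)"
  proof
    fix x assume "x \<in> (\<Union>n. E n)"
    then obtain n i where "x \<in> C n i" using C(1) by blast
    then have "x \<in> D (prod_encode (n, i))" by (simp add: D_def)
    then show "x \<in> (\<Union>k. D k)" by blast
  qed
  moreover have "bounded (D k)" for k
    using C(2) by (simp add: D_def split: prod.split)
  ultimately show "\<exists>C. (\<Union>n. E n) \<subseteq> (\<Union>i::nat. C i) \<and> (\<forall>i. bounded (C i)) \<and>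
       (\<Sum>i. ennreal (diameter (C i))) \<le> ennreal \<epsilon>"
    using * by blast
qed

lemma hausdorff_1_empty: "hausdorff_1 {} = 0"
  unfolding hausdorff_1_eq_0_iff by (auto intro!: exI[of _ "\<lambda>_. {}"])

lemma hausdorff_1_Un_null:
  assumes "hausdorff_1 A = 0" "hausdorff_1 B = 0"
  shows "hausdorff_1 (A \<union> B) = 0"
proof -
  have "hausdorff_1 (\<Union>n::nat. if n = 0 then A else B) = 0"
    using assms by (intro hausdorff_1_UN_null) auto
  then show ?thesis by (rule hausdorff_1_mono_null) (auto split: if_splits)
qed

text \<open>By Lindelof, countably many of the neighbourhoods already cover \<open>S\<close>. They
  live in the domain of \<open>k\<close>, since \<open>k\<close> will be a curve and the estimates
  for curves are made on open sets of parameters.\<close>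

lemma hausdorff_1_locally_null:
  fixes k :: "'b::second_countable_topology \<Rightarrow> 'a::metric_space"
  assumes "\<And>t. t \<in> S \<Longrightarrow> \<exists>W. open W \<and> t \<in> W \<and> hausdorff_1 (k ` (S \<inter> W)) = 0"
  shows "hausdorff_1 (k ` S) = 0"
proof -
  define \<F> where "\<F> = {W. open W \<and> hausdorff_1 (k ` (S \<inter> W)) = 0}"
  obtain \<G> where \<G>: "\<G> \<subseteq> \<F>" "countable \<G>" "\<Union>\<G> = \<Union>\<F>"
    using Lindelof_openin[of \<F> UNIV] by (auto simp: \<F>_def)
  have "S \<subseteq> \<Union>\<G>"
    using assms unfolding \<G>(3) by (auto simp: \<F>_def)
  show ?thesis
  proof (cases "\<G> = {}")
    case True
    with \<open>S \<subseteq> \<Union>\<G>\<close> show ?thesis by (simp add: hausdorff_1_empty)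
  next
    case False
    have "from_nat_into \<G> n \<in> \<F>" for n
      using from_nat_into[OF False] \<G>(1) by blast
    then have "hausdorff_1 (\<Union>n. k ` (S \<inter> from_nat_into \<G> n)) = 0"
      by (intro hausdorff_1_UN_null) (simp add: \<F>_def)
    moreover have "k ` S \<subseteq> (\<Union>n. k ` (S \<inter> from_nat_into \<G> n))"
    proof
      fix y assume "y \<in> k ` S"
      then obtain t W where t: "t \<in> S" "y = k t" "t \<in> W" "W \<in> \<G>"
        using \<open>S \<subseteq> \<Union>\<G>\<close> by blast
      then obtain n where "from_nat_into \<G> n = W"
        using from_nat_into_surj[OF \<G>(2)] by blast
      with t show "y \<in> (\<Union>n. k ` (S \<inter> from_nat_into \<G> n))" by blast
    qed
    ultimately show ?thesis by (rule hausdorff_1_mono_null)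
  qed
qed

text \<open>On \<open>Q\<close> the map \<open>h\<close> has an inverse with Lipschitz constant
  \<open>1/c\<close>, so a cover of the image pulls back to a cover of \<open>Q\<close> whose
  diameters grow by at most that factor. Starting from a total of \<open>c * \<epsilon>\<close>
  compensates for it.\<close>

lemma hausdorff_1_null_of_expanding_image:
  fixes h :: "'a::euclidean_space \<Rightarrow> 'b::metric_space"
  assumes "c > 0" and expand: "\<And>y z. y \<in> Q \<Longrightarrow> z \<in> Q \<Longrightarrow> c * dist y z \<le> dist (h y) (h z)"
    and null: "hausdorff_1 (h ` Q) = 0"
  shows "hausdorff_1 Q = 0"
  unfolding hausdorff_1_eq_0_iff
proof (intro allI impI)
  fix \<epsilon> :: real assume "\<epsilon> > 0"
  then obtain C :: "nat \<Rightarrow> 'b set" where C: "h ` Q \<subseteq> (\<Union>i. C i)" "\<And>i. bounded (C i)"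
    and le: "(\<Sum>i. ennreal (diameter (C i))) \<le> ennreal (c * \<epsilon>)"
    using null \<open>c > 0\<close> unfolding hausdorff_1_eq_0_iff by (meson mult_pos_pos)
  define D where "D i = Q \<inter> h -` C i" for i
  have d: "dist y z \<le> diameter (C i) / c" if "y \<in> D i" "z \<in> D i" for y z i
  proof -
    have "c * dist y z \<le> dist (h y) (h z)" using expand that by (simp add: D_def)
    also have "\<dots> \<le> diameter (C i)"
      using that C(2) by (intro diameter_bounded_bound) (auto simp: D_def)
    finally show ?thesis using \<open>c > 0\<close> by (simp add: field_simps)
  qed
  have bd: "bounded (D i)" for i
    unfolding bounded_two_points using d by blast
  have "diameter (D i) \<le> diameter (C i) / c" for i
    using d[of _ i] diameter_ge_0[OF C(2), of i] \<open>c > 0\<close>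
    by (intro diameter_le) (auto simp: dist_norm)
  then have "ennreal (diameter (D i)) \<le> ennreal (1/c) * ennreal (diameter (C i))" for i
    using \<open>c > 0\<close> diameter_ge_0[OF C(2), of i]
    by (subst ennreal_mult[symmetric]) (auto intro!: ennreal_leI)
  then have "(\<Sum>i. ennreal (diameter (D i))) \<le> (\<Sum>i. ennreal (1/c) * ennreal (diameter (C i)))"
    by (intro suminf_le) auto
  also have "\<dots> = ennreal (1/c) * (\<Sum>i. ennreal (diameter (C i)))"
    by simp
  also have "\<dots> \<le> ennreal (1/c) * ennreal (c * \<epsilon>)"
    by (intro mult_left_mono le) simp
  also have "\<dots> = ennreal \<epsilon>"
    using \<open>c > 0\<close> \<open>\<epsilon> > 0\<close> by (subst ennreal_mult[symmetric]) auto
  finally have "(\<Sum>i. ennreal (diameter (D i))) \<le> ennreal \<epsilon>" .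
  moreover have "Q \<subseteq> (\<Union>i. D i)" using C(1) by (force simp: D_def)
  ultimately show "\<exists>C. Q \<subseteq> (\<Union>i::nat. C i) \<and> (\<forall>i. bounded (C i)) \<and>
       (\<Sum>i. ennreal (diameter (C i))) \<le> ennreal \<epsilon>"
    using bd by blast
qed

text \<open>A nonempty bounded set of reals lies in the closed interval centred at one of its points
  with its diameter as radius. The interval is twice as long as the diameter, hence the initial
  budget \<open>e/2\<close>.\<close>

lemma hausdorff_1_null_imp_negligible:
  fixes S :: "real set"
  assumes "hausdorff_1 S = 0"
  shows "negligible S"
  unfolding negligible_outer_le
proof (intro allI impI)
  fix e :: real assume "e > 0"
  then obtain C :: "nat \<Rightarrow> real set" where C: "S \<subseteq> (\<Union>i. C i)" "\<And>i. bounded (C i)"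
    and le: "(\<Sum>i. ennreal (diameter (C i))) \<le> ennreal (e/2)"
    using assms unfolding hausdorff_1_eq_0_iff by (meson half_gt_zero)
  \<comment> \<open>For an empty \<open>C i\<close> this choice is arbitrary, which is why
    \<open>T\<close> treats that case separately.\<close>
  define x where "x i = (SOME x. x \<in> C i)" for i
  define T where "T i = (if C i = {} then {} else cball (x i) (diameter (C i)))" for i
  have sub: "C i \<subseteq> T i" for i
  proof (cases "C i = {}")
    case False
    then have "x i \<in> C i" unfolding x_def by (simp add: some_in_eq)
    then show ?thesis
      using diameter_bounded_bound[OF C(2)] by (auto simp: T_def)
  qed simp
  have em: "emeasure lebesgue (T i) \<le> ennreal 2 * ennreal (diameter (C i))" for i
    using diameter_ge_0[OF C(2), of i]
    by (auto simp: T_def cball_eq_atLeastAtMost ennreal_mult)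
  have Tm: "T i \<in> sets lebesgue" for i by (simp add: T_def)
  have "emeasure lebesgue (\<Union>i. T i) \<le> (\<Sum>i. emeasure lebesgue (T i))"
    using Tm by (intro emeasure_subadditive_countably) auto
  also have "\<dots> \<le> (\<Sum>i. ennreal 2 * ennreal (diameter (C i)))"
    by (intro suminf_le em) auto
  also have "\<dots> = ennreal 2 * (\<Sum>i. ennreal (diameter (C i)))"
    by (rule ennreal_suminf_cmult)
  also have "\<dots> \<le> ennreal 2 * ennreal (e/2)"
    by (intro mult_left_mono le) simp
  also have "\<dots> = ennreal e"
    using \<open>e > 0\<close> by (subst ennreal_mult[symmetric]) auto
  finally have *: "emeasure lebesgue (\<Union>i. T i) \<le> ennreal e" .
  have Tl: "(\<Union>i. T i) \<in> lmeasurable"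
    using Tm * by (intro fmeasurableI) (auto simp: le_less_trans)
  moreover have "measure lebesgue (\<Union>i. T i) \<le> e"
    using * \<open>e > 0\<close> Tl by (simp add: emeasure_eq_measure2)
  moreover have "S \<subseteq> (\<Union>i. T i)" using C(1) sub by blast
  ultimately show "\<exists>T. S \<subseteq> T \<and> T \<in> lmeasurable \<and> measure lebesgue T \<le> e" by blast
qed

subsection \<open>Lipschitz curves with null coordinate images\<close>

text \<open>The intervals are the components of \<open>U\<close>; a disjoint family of open sets is
  countable by separability.\<close>

lemma open_real_disjoint_intervals:
  fixes U :: "real set"
  assumes "open U"
  obtains D :: "nat \<Rightarrow> real set"
  where "disjoint_family D" "\<And>i. open (D i)" "\<And>i. connected (D i)" "(\<Union>i. D i) = U"
proof -
  define K where "K = components U"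
  have opn: "open C" if "C \<in> K" for C
    using that assms open_components by (auto simp: K_def)
  have disj: "disjoint K"
    using pairwise_disjoint_components[of U] by (simp add: K_def disjoint_def pairwise_def disjnt_def)
  have cnt: "countable K"
    using countable_disjoint_open_subsets[of K] opn disj by blast
  \<comment> \<open>Indices that number no component receive the empty set, so finitely many
    components also form a disjoint sequence.\<close>
  define D where "D i = (if i \<in> to_nat_on K ` K then from_nat_into K i else {})" for i
  have D: "D (to_nat_on K C) = C" if "C \<in> K" for C
    using that cnt by (simp add: D_def)
  have D': "D i = {} \<or> (\<exists>C\<in>K. i = to_nat_on K C \<and> D i = C)" for i
    using cnt by (auto simp: D_def)
  show thesis
  proof
    show "disjoint_family D"
      using D' disj cnt unfolding disjoint_family_on_def disjoint_def by (metis Int_empty_left Int_empty_right)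
    show "open (D i)" for i using D'[of i] opn by auto
    show "connected (D i)" for i
      using D'[of i] in_components_connected by (auto simp: K_def)
    show "(\<Union>i. D i) = U"
    proof
      show "(\<Union>i. D i) \<subseteq> U"
        using D' in_components_subset unfolding K_def by (metis UN_least empty_subsetI)
      have "U = \<Union>K" by (simp add: K_def Union_components)
      then show "U \<subseteq> (\<Union>i. D i)" using D by blast
    qed
  qed
qed

lemma dist_le_measure_interval:
  fixes I :: "real set"
  assumes "connected I" "I \<in> lmeasurable" "x \<in> I" "y \<in> I"
  shows "\<bar>x - y\<bar> \<le> measure lebesgue I"
proof -
  have "{min x y..max x y} \<subseteq> I"
    by (rule connected_contains_Icc[OF assms(1)]) (use assms(3,4) in \<open>simp_all add: min_def max_def\<close>)
  then have "measure lebesgue {min x y..max x y} \<le> measure lebesgue I"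
    using assms(2) by (intro measure_mono_fmeasurable) auto
  then show ?thesis by (auto simp: min_def max_def split: if_splits)
qed

text \<open>The factor 2 is not sharp; it comes from covering by balls centred at points of the image.\<close>

lemma lipschitz_image_outer_measure:
  fixes h :: "real \<Rightarrow> real"
  assumes X: "X \<in> lmeasurable" and lip: "L-lipschitz_on X h" and "e > 0"
  obtains T where "T \<in> lmeasurable" "h ` X \<subseteq> T"
    "measure lebesgue T \<le> 2 * L * (measure lebesgue X + e)"
proof -
  have "L \<ge> 0" using lip by (rule lipschitz_on_nonneg)
  obtain U where U: "open U" "X \<subseteq> U" "U - X \<in> lmeasurable" "emeasure lebesgue (U - X) < ennreal e"
    using sets_lebesgue_outer_open[OF fmeasurableD[OF X] \<open>e > 0\<close>] by blast
  have "measure lebesgue (U - X) \<le> e"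
    using U(3,4) \<open>e > 0\<close> by (simp add: emeasure_eq_measure2 ennreal_less_iff)
  have UX: "U = X \<union> (U - X)" using U(2) by blast
  have Ul: "U \<in> lmeasurable"
    by (subst UX) (use X U(3) in \<open>rule fmeasurable.Un\<close>)
  have mU: "measure lebesgue U \<le> measure lebesgue X + e"
    using measure_Un_le[of X lebesgue "U - X"] X U(3) UX[symmetric] \<open>measure lebesgue (U - X) \<le> e\<close>
    by (simp add: fmeasurableD)
  obtain D :: "nat \<Rightarrow> real set" where D: "disjoint_family D" "\<And>i. open (D i)" "\<And>i. connected (D i)" "(\<Union>i. D i) = U"
    using open_real_disjoint_intervals[OF U(1)] by metis
  have Dl: "D i \<in> lmeasurable" for i
    using D(2,4) Ul by (intro fmeasurableI2[OF Ul]) auto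
  \<comment> \<open>The centre comes from \<open>X\<close> because the Lipschitz bound is assumed
    only there. Two points of the interval \<open>D i\<close> differ by at most its length, which
    gives the radius below.\<close>
  define x where "x i = (SOME x. x \<in> X \<inter> D i)" for i
  define T where "T i = (if X \<inter> D i = {} then {} else cball (h (x i)) (L * measure lebesgue (D i)))" for i
  have Tm: "T i \<in> sets lebesgue" for i by (simp add: T_def)
  have sub: "h y \<in> T i" if "y \<in> X" "y \<in> D i" for y i
  proof -
    have xi: "x i \<in> X \<inter> D i"
      unfolding x_def by (rule someI) (use that in blast)
    then have "dist (h (x i)) (h y) \<le> L * dist (x i) y"
      using that lip by (intro lipschitz_onD) auto
    also have "dist (x i) y \<le> measure lebesgue (D i)"
      using dist_le_measure_interval[OF D(3) Dl, of "x i" i y] xi that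
      by (simp add: dist_real_def)
    finally have "dist (h (x i)) (h y) \<le> L * measure lebesgue (D i)"
      using \<open>L \<ge> 0\<close> by (simp add: mult_left_mono)
    then show ?thesis
      using xi by (auto simp: T_def)
  qed
  have em: "emeasure lebesgue (T i) \<le> ennreal (2 * L) * emeasure lebesgue (D i)" for i
    using \<open>L \<ge> 0\<close> Dl[of i]
    by (auto simp: T_def cball_eq_atLeastAtMost ennreal_mult[symmetric] emeasure_eq_measure2)
  have "emeasure lebesgue (\<Union>i. T i) \<le> (\<Sum>i. emeasure lebesgue (T i))"
    using Tm by (intro emeasure_subadditive_countably) auto
  also have "\<dots> \<le> (\<Sum>i. ennreal (2 * L) * emeasure lebesgue (D i))"
    by (intro suminf_le em) auto
  also have "\<dots> = ennreal (2 * L) * (\<Sum>i. emeasure lebesgue (D i))"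
    by (rule ennreal_suminf_cmult)
  also have "(\<Sum>i. emeasure lebesgue (D i)) = emeasure lebesgue U"
    using D Dl by (subst suminf_emeasure) (auto simp: fmeasurableD)
  also have "ennreal (2 * L) * emeasure lebesgue U = ennreal (2 * L * measure lebesgue U)"
    using Ul \<open>L \<ge> 0\<close> by (simp add: emeasure_eq_measure2 ennreal_mult)
  finally have *: "emeasure lebesgue (\<Union>i. T i) \<le> ennreal (2 * L * measure lebesgue U)" .
  have Tl: "(\<Union>i. T i) \<in> lmeasurable"
    using Tm * by (intro fmeasurableI) (auto simp: le_less_trans)
  show thesis
  proof
    show "(\<Union>i. T i) \<in> lmeasurable" by fact
    show "h ` X \<subseteq> (\<Union>i. T i)" using sub U(2) D(4) by blast
    have "measure lebesgue (\<Union>i. T i) \<le> 2 * L * measure lebesgue U"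
      using * \<open>L \<ge> 0\<close> Tl by (simp add: emeasure_eq_measure2)
    also have "\<dots> \<le> 2 * L * (measure lebesgue X + e)"
      using mU \<open>L \<ge> 0\<close> by (intro mult_left_mono) auto
    finally show "measure lebesgue (\<Union>i. T i) \<le> 2 * L * (measure lebesgue X + e)" .
  qed
qed

text \<open>The image of the interval \<open>I\<close> is an interval containing \<open>h s\<close>
  and \<open>h t\<close>. Up to a null set it is covered by the image of \<open>I - S\<close>, whose
  outer measure is controlled by the Lipschitz bound.\<close>

lemma oscillation_le_measure_Diff:
  fixes h :: "real \<Rightarrow> real"
  assumes I: "connected I" and lip: "L-lipschitz_on I h"
    and null: "negligible (h ` (I \<inter> S))" and meas: "I - S \<in> lmeasurable"
    and st: "s \<in> I" "t \<in> I"
  shows "\<bar>h s - h t\<bar> \<le> 2 * L * measure lebesgue (I - S)"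
proof -
  have "L \<ge> 0" using lip by (rule lipschitz_on_nonneg)
  have *: "\<bar>h s - h t\<bar> \<le> 2 * L * (measure lebesgue (I - S) + e)" if e: "e > 0" for e
  proof -
    have "L-lipschitz_on (I - S) h" using lip by (rule lipschitz_on_subset) blast
    then obtain T where T: "T \<in> lmeasurable" "h ` (I - S) \<subseteq> T"
        "measure lebesgue T \<le> 2 * L * (measure lebesgue (I - S) + e)"
      using lipschitz_image_outer_measure[OF meas _ e] by metis
    let ?N = "h ` (I \<inter> S)"
    have N: "?N \<in> lmeasurable" "measure lebesgue ?N = 0"
      using null by (simp_all add: negligible_iff_measure)
    have "connected (h ` I)"
      using I lipschitz_on_continuous_on[OF lip] by (rule connected_continuous_image[rotated])
    then have "{min (h s) (h t)..max (h s) (h t)} \<subseteq> h ` I"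
      by (rule connected_contains_Icc) (use st in \<open>simp_all add: min_def max_def\<close>)
    also have "h ` I \<subseteq> T \<union> ?N" using T(2) by blast
    finally have "measure lebesgue {min (h s) (h t)..max (h s) (h t)} \<le> measure lebesgue (T \<union> ?N)"
      using T N by (intro measure_mono_fmeasurable) auto
    also have "\<dots> \<le> measure lebesgue T + measure lebesgue ?N"
      using T N by (intro measure_Un_le) (auto simp: fmeasurableD)
    finally show ?thesis using T(3) N(2) by (auto simp: min_def max_def split: if_splits)
  qed
  show ?thesis
  proof (rule field_le_epsilon)
    fix e :: real assume "e > 0"
    \<comment> \<open>The divisor \<open>2 * L + 1\<close> stays positive when
      \<open>L = 0\<close>.\<close>
    have "\<bar>h s - h t\<bar> \<le> 2 * L * (measure lebesgue (I - S) + e / (2 * L + 1))"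
      using \<open>e > 0\<close> \<open>L \<ge> 0\<close> by (intro *) auto
    also have "\<dots> = 2 * L * measure lebesgue (I - S) + e * (2 * L / (2 * L + 1))"
      by (simp add: algebra_simps)
    also have "e * (2 * L / (2 * L + 1)) \<le> e * 1"
      using \<open>e > 0\<close> \<open>L \<ge> 0\<close> by (intro mult_left_mono) auto
    finally show "\<bar>h s - h t\<bar> \<le> 2 * L * measure lebesgue (I - S) + e" by simp
  qed
qed

text \<open>Adding the oscillation bounds of the coordinates shows that \<open>g\<close> maps each
  interval \<open>D i\<close> to a set of diameter at most a constant times the measure of
  \<open>D i - R\<close>. The intervals are disjoint, so these measures add up to at most that of
  \<open>U - R\<close>, which is as small as desired.\<close>

lemma lipschitz_curve_null_of_null_coordinates:
  fixes g :: "real \<Rightarrow> real^'d"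
  assumes W: "open W" and lip: "L-lipschitz_on W g" and S: "S \<subseteq> W"
    and null: "\<And>j. negligible ((\<lambda>t. g t $ j) ` S)"
  shows "hausdorff_1 (g ` S) = 0"
proof -
  have "L \<ge> 0" using lip by (rule lipschitz_on_nonneg)
  have lipj: "L-lipschitz_on W (\<lambda>t. g t $ j)" for j
    using lip unfolding lipschitz_on_def by (meson dist_vec_nth_le order_trans)
  \<comment> \<open>The enclosing null sets are Borel: preimages of Borel sets under the continuous
    coordinates are Borel on \<open>W\<close>, while preimages of Lebesgue sets need not even be
    measurable.\<close>
  have "\<exists>N. N \<in> null_sets lborel \<and> (\<lambda>t. g t $ j) ` S \<subseteq> N" for j
    using null[of j] by (auto simp: negligible_iff_null_sets null_sets_completion_iff2)
  then obtain N where N: "\<And>j. N j \<in> null_sets lborel" "\<And>j. (\<lambda>t. g t $ j) ` S \<subseteq> N j"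
    by metis
  text \<open>\<open>S\<close> need not be measurable, so it is enlarged to a Borel set whose coordinate images are
    still null.\<close>
  define R where "R = (\<Inter>j. W \<inter> (\<lambda>t. g t $ j) -` N j)"
  have "W \<inter> (\<lambda>t. g t $ j) -` N j \<in> sets borel" for j
  proof -
    have gm: "(\<lambda>t. g t $ j) \<in> borel_measurable (restrict_space borel W)"
      using lipschitz_on_continuous_on[OF lipj] by (rule borel_measurable_continuous_on_restrict)
    have Nm: "N j \<in> sets borel" using N(1)[of j] by auto
    have "(\<lambda>t. g t $ j) -` N j \<inter> W \<in> sets (restrict_space borel W)"
      using measurable_sets[OF gm Nm] by (simp add: space_restrict_space)
    then show ?thesis
      using W by (simp add: sets_restrict_space_iff Int_commute)
  qed
  then have R: "R \<in> sets lebesgue" unfolding R_def by (intro sets.finite_INT) auto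
  have SR: "S \<subseteq> R" using S N(2) by (force simp: R_def)
  have RW: "R \<subseteq> W" by (auto simp: R_def)
  have Rnull: "negligible ((\<lambda>t. g t $ j) ` (I \<inter> R))" for I j
  proof -
    have "negligible (N j)"
      using N(1) by (simp add: negligible_iff_null_sets null_sets_completionI)
    then show ?thesis by (rule negligible_subset) (auto simp: R_def)
  qed
  show ?thesis
    unfolding hausdorff_1_eq_0_iff
  proof (intro allI impI)
    fix \<epsilon> :: real assume "\<epsilon> > 0"
    \<comment> \<open>One oscillation constant \<open>2 * L\<close> for each coordinate, since the
      norm is bounded by the sum of the absolute values of the coordinates.\<close>
    define M where "M = real CARD('d) * (2 * L)"
    have "M \<ge> 0" using \<open>L \<ge> 0\<close> by (simp add: M_def)
    define \<eta> where "\<eta> = \<epsilon> / (M + 1)"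
    have "\<eta> > 0" using \<open>\<epsilon> > 0\<close> \<open>M \<ge> 0\<close> by (simp add: \<eta>_def)
    obtain U where U: "open U" "R \<subseteq> U" "U - R \<in> lmeasurable" "emeasure lebesgue (U - R) < ennreal \<eta>"
      using sets_lebesgue_outer_open[OF R \<open>\<eta> > 0\<close>] by blast
    \<comment> \<open>The intervals are taken in \<open>U \<inter> W\<close>: inside
      \<open>W\<close> for the Lipschitz bound, inside \<open>U\<close> for the smallness of
      \<open>D i - R\<close>.\<close>
    obtain D :: "nat \<Rightarrow> real set" where D: "disjoint_family D" "\<And>i. open (D i)" "\<And>i. connected (D i)"
        "(\<Union>i. D i) = U \<inter> W"
      using open_real_disjoint_intervals[OF open_Int[OF U(1) W]] by metis
    have DW: "D i \<subseteq> W" "D i \<subseteq> U" for i using D(4) by auto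
    have Dl: "D i - R \<in> lmeasurable" for i
      using R D(2)[of i] DW[of i] by (intro fmeasurableI2[OF U(3)]) auto
    have norm: "norm (g s - g t) \<le> M * measure lebesgue (D i - R)" if "s \<in> D i" "t \<in> D i" for s t i
    proof -
      have "norm (g s - g t) \<le> (\<Sum>j\<in>UNIV. \<bar>(g s - g t) $ j\<bar>)" by (rule norm_le_l1_cart)
      also have "\<dots> \<le> (\<Sum>j\<in>(UNIV::'d set). 2 * L * measure lebesgue (D i - R))"
      proof (rule sum_mono)
        fix j
        show "\<bar>(g s - g t) $ j\<bar> \<le> 2 * L * measure lebesgue (D i - R)"
          using oscillation_le_measure_Diff[OF D(3) lipschitz_on_subset[OF lipj DW(1)] Rnull Dl that, of j]
          by simp
      qed
      also have "\<dots> = M * measure lebesgue (D i - R)" by (simp add: M_def)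
      finally show ?thesis .
    qed
    have bd: "bounded (g ` D i)" for i
      unfolding bounded_two_points using norm by (auto simp: dist_norm)
    have "diameter (g ` D i) \<le> M * measure lebesgue (D i - R)" for i
      using norm \<open>M \<ge> 0\<close> by (intro diameter_le) auto
    then have "ennreal (diameter (g ` D i)) \<le> ennreal M * emeasure lebesgue (D i - R)" for i
      using Dl[of i] \<open>M \<ge> 0\<close> by (auto simp: emeasure_eq_measure2 ennreal_mult[symmetric] intro!: ennreal_leI)
    then have "(\<Sum>i. ennreal (diameter (g ` D i))) \<le> (\<Sum>i. ennreal M * emeasure lebesgue (D i - R))"
      by (intro suminf_le) auto
    also have "\<dots> = ennreal M * (\<Sum>i. emeasure lebesgue (D i - R))"
      by (rule ennreal_suminf_cmult)
    also have "(\<Sum>i. emeasure lebesgue (D i - R)) = emeasure lebesgue (\<Union>i. D i - R)"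
      using D(1) Dl by (intro suminf_emeasure) (auto simp: fmeasurableD disjoint_family_on_def)
    also have "\<dots> \<le> emeasure lebesgue (U - R)"
      using DW(2) U(3) by (intro emeasure_mono) (auto simp: fmeasurableD)
    also have "\<dots> \<le> ennreal \<eta>" using U(4) by simp
    also have "ennreal M * ennreal \<eta> \<le> ennreal \<epsilon>"
      using \<open>M \<ge> 0\<close> \<open>\<epsilon> > 0\<close>
      by (auto simp: \<eta>_def ennreal_mult[symmetric] field_simps intro!: ennreal_leI)
    finally have "(\<Sum>i. ennreal (diameter (g ` D i))) \<le> ennreal \<epsilon>"
      by (simp add: mult_left_mono)
    moreover have "g ` S \<subseteq> (\<Union>i. g ` D i)"
      using SR RW U(2) unfolding image_UN[symmetric] D(4) by blast
    ultimately show "\<exists>C. g ` S \<subseteq> (\<Union>i::nat. C i) \<and> (\<forall>i. bounded (C i)) \<and>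
       (\<Sum>i. ennreal (diameter (C i))) \<le> ennreal \<epsilon>"
      using bd by (intro exI[of _ "\<lambda>i. g ` D i"]) simp
  qed
qed

subsection \<open>Strict differentiability\<close>

text \<open>The strict derivative: both points vary near \<open>x\<close>, whereas the Frechet
  derivative keeps one of them at \<open>x\<close>. Expansion between two arbitrary nearby points
  requires this uniformity. The notion is stated at a single point and is stable under arithmetic,
  so it passes to determinants without a formula for their derivative.\<close>

definition strictly_differentiable ::
    "('a::real_normed_vector \<Rightarrow> 'b::real_normed_vector) \<Rightarrow> ('a \<Rightarrow> 'b) \<Rightarrow> 'a \<Rightarrow> bool" where
  "strictly_differentiable f f' x \<longleftrightarrow> bounded_linear f' \<and>
     (\<forall>e>0. \<forall>\<^sub>F (y, z) in nhds x \<times>\<^sub>F nhds x. norm (f y - f z - f' (y - z)) \<le> e * norm (y - z))"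

lemma strictly_differentiableI:
  assumes "bounded_linear f'"
    and "\<And>e. e > 0 \<Longrightarrow> \<exists>d>0. \<forall>y\<in>ball x d. \<forall>z\<in>ball x d. norm (f y - f z - f' (y - z)) \<le> e * norm (y - z)"
  shows "strictly_differentiable f f' x"
  unfolding strictly_differentiable_def
proof (intro conjI allI impI)
  fix e :: real assume "e > 0"
  then obtain d where "d > 0"
    and d: "\<forall>y\<in>ball x d. \<forall>z\<in>ball x d. norm (f y - f z - f' (y - z)) \<le> e * norm (y - z)"
    using assms(2) by blast
  from \<open>d > 0\<close> have "\<forall>\<^sub>F y in nhds x. y \<in> ball x d"
    by (intro eventually_nhds_in_open) auto
  then show "\<forall>\<^sub>F (y, z) in nhds x \<times>\<^sub>F nhds x. norm (f y - f z - f' (y - z)) \<le> e * norm (y - z)"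
    unfolding eventually_prod_filter using d by blast
qed fact

lemma strictly_differentiableD:
  assumes "strictly_differentiable f f' x" "e > 0"
  obtains d where "d > 0"
    "\<And>y z. y \<in> ball x d \<Longrightarrow> z \<in> ball x d \<Longrightarrow> norm (f y - f z - f' (y - z)) \<le> e * norm (y - z)"
proof -
  obtain P Q where "eventually P (nhds x)" "eventually Q (nhds x)"
    and PQ: "\<And>y z. P y \<Longrightarrow> Q z \<Longrightarrow> norm (f y - f z - f' (y - z)) \<le> e * norm (y - z)"
    using assms unfolding strictly_differentiable_def eventually_prod_filter by fastforce
  then have "\<forall>\<^sub>F y in nhds x. P y \<and> Q y" by (simp add: eventually_conj)
  then obtain d where "d > 0" "\<forall>y. dist y x < d \<longrightarrow> P y \<and> Q y"
    unfolding eventually_nhds_metric by blast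
  then show thesis using PQ by (intro that[of d]) (auto simp: dist_commute)
qed

lemma strictly_differentiable_imp_has_derivative:
  assumes "strictly_differentiable f f' x"
  shows "(f has_derivative f') (at x)"
  unfolding has_derivative_at_alt
proof (intro conjI allI impI)
  show "bounded_linear f'" using assms by (simp add: strictly_differentiable_def)
  fix e :: real assume "e > 0"
  then obtain d where d: "d > 0"
    "\<And>y z. y \<in> ball x d \<Longrightarrow> z \<in> ball x d \<Longrightarrow> norm (f y - f z - f' (y - z)) \<le> e * norm (y - z)"
    using strictly_differentiableD[OF assms] by metis
  then show "\<exists>d>0. \<forall>y. norm (y - x) < d \<longrightarrow> norm (f y - f x - f' (y - x)) \<le> e * norm (y - x)"
    by (intro exI[of _ d]) (auto simp: dist_norm norm_minus_commute)
qed

lemma strictly_differentiable_imp_lipschitz: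
  assumes "strictly_differentiable f f' x"
  obtains d L where "d > 0" "L-lipschitz_on (ball x d) f"
proof -
  obtain K where K: "K \<ge> 0" "\<And>v. norm (f' v) \<le> norm v * K"
    using assms bounded_linear.nonneg_bounded unfolding strictly_differentiable_def by blast
  obtain d where d: "d > 0"
    "\<And>y z. y \<in> ball x d \<Longrightarrow> z \<in> ball x d \<Longrightarrow> norm (f y - f z - f' (y - z)) \<le> 1 * norm (y - z)"
    using strictly_differentiableD[OF assms zero_less_one] by metis
  show thesis
  proof
    show "(K + 1)-lipschitz_on (ball x d) f"
    proof (rule lipschitz_onI)
      fix y z assume yz: "y \<in> ball x d" "z \<in> ball x d"
      have "norm (f y - f z) \<le> norm (f y - f z - f' (y - z)) + norm (f' (y - z))"
        by (metis diff_add_cancel norm_triangle_ineq)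
      then show "dist (f y) (f z) \<le> (K + 1) * dist y z"
        using d(2)[OF yz] K(2)[of "y - z"] by (simp add: dist_norm algebra_simps)
    qed (use K in simp)
  qed fact
qed

text \<open>In finite dimension an injective linear map is bounded below by some
  \<open>B > 0\<close>; an error of at most \<open>B/2\<close> leaves the constant
  \<open>B/2\<close>. The codomain may have larger dimension, as it will for the pair formed at fold
  points.\<close>

lemma strictly_differentiable_injective_imp_expanding:
  fixes f :: "'a::euclidean_space \<Rightarrow> 'b::euclidean_space"
  assumes "strictly_differentiable f f' x" "inj f'"
  obtains d c where "d > 0" "c > 0"
    "\<And>y z. y \<in> ball x d \<Longrightarrow> z \<in> ball x d \<Longrightarrow> c * dist y z \<le> dist (f y) (f z)"
proof -
  have "linear f'"
    using assms(1) by (simp add: strictly_differentiable_def bounded_linear.linear)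
  then obtain B where B: "B > 0" "\<And>v. B * norm v \<le> norm (f' v)"
    using linear_inj_bounded_below_pos assms(2) by blast
  then obtain d where d: "d > 0"
    "\<And>y z. y \<in> ball x d \<Longrightarrow> z \<in> ball x d \<Longrightarrow> norm (f y - f z - f' (y - z)) \<le> B/2 * norm (y - z)"
    using strictly_differentiableD[OF assms(1)] by (metis half_gt_zero)
  show thesis
  proof (rule that[of d "B/2"])
    fix y z assume yz: "y \<in> ball x d" "z \<in> ball x d"
    have "norm (f' (y - z)) \<le> norm (f y - f z) + norm (f y - f z - f' (y - z))"
      by (metis add_diff_cancel_left' diff_add_cancel norm_minus_commute norm_triangle_sub add.commute)
    then show "B/2 * dist y z \<le> dist (f y) (f z)"
      using d(2)[OF yz] B(2)[of "y - z"] by (simp add: dist_norm)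
  qed (use d B in auto)
qed

text \<open>The mean value inequality is applied to \<open>f\<close> minus the linear map
  \<open>f' x\<close>: its derivative at \<open>w\<close> is \<open>f' w - f' x\<close>, which is
  small near \<open>x\<close>. The general codomain allows the lemma to be used both for a function
  and for its operator-valued derivative.\<close>

lemma C1_imp_strictly_differentiable:
  fixes f' :: "'a::real_normed_vector \<Rightarrow> 'a \<Rightarrow>\<^sub>L 'b::real_normed_vector"
  assumes "open S" "x \<in> S" "\<And>z. z \<in> S \<Longrightarrow> (f has_derivative blinfun_apply (f' z)) (at z)"
    and cont: "isCont f' x"
  shows "strictly_differentiable f (blinfun_apply (f' x)) x"
proof (rule strictly_differentiableI)
  show "bounded_linear (blinfun_apply (f' x))" by (rule blinfun.bounded_linear_right)
  fix e :: real assume "e > 0"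
  then obtain d1 where d1: "d1 > 0" "\<And>z. dist z x < d1 \<Longrightarrow> dist (f' z) (f' x) < e"
    using cont unfolding continuous_at_eps_delta by blast
  obtain d2 where d2: "d2 > 0" "ball x d2 \<subseteq> S"
    using assms(1,2) open_contains_ball by blast
  define d where "d = min d1 d2"
  have S: "z \<in> S" if "z \<in> ball x d" for z
    using that d2 by (auto simp: d_def)
  have "norm ((f y - f' x y) - (f z - f' x z)) \<le> e * norm (y - z)"
    if "y \<in> ball x d" "z \<in> ball x d" for y z
  proof (rule differentiable_bound[OF convex_ball _ _ that])
    fix w assume w: "w \<in> ball x d"
    have "((\<lambda>u. f u - f' x u) has_derivative blinfun_apply (f' w - f' x)) (at w)"
      using assms(3)[OF S[OF w]]
      by (auto intro!: derivative_eq_intros simp: blinfun.bilinear_simps)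
    then show "((\<lambda>u. f u - f' x u) has_derivative blinfun_apply (f' w - f' x)) (at w within ball x d)"
      by (rule has_derivative_at_withinI)
    have "dist (f' w) (f' x) < e" using w by (intro d1) (auto simp: d_def dist_commute)
    then show "onorm (blinfun_apply (f' w - f' x)) \<le> e"
      by (simp add: dist_norm norm_blinfun.rep_eq)
  qed
  then show "\<exists>d>0. \<forall>y\<in>ball x d. \<forall>z\<in>ball x d.
      norm (f y - f z - blinfun_apply (f' x) (y - z)) \<le> e * norm (y - z)"
    using d1(1) d2(1) by (intro exI[of _ d]) (auto simp: d_def blinfun.bilinear_simps algebra_simps)
qed

section \<open>Calculus rules for strict derivatives, up to determinants and slices\<close>

lemma strictly_differentiable_const: "strictly_differentiable (\<lambda>_. c) (\<lambda>_. 0) x"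
  by (rule strictly_differentiableI) (auto intro: bounded_linear_zero exI[of _ 1])

lemma strictly_differentiable_add:
  assumes f: "strictly_differentiable f f' x" and g: "strictly_differentiable g g' x"
  shows "strictly_differentiable (\<lambda>y. f y + g y) (\<lambda>v. f' v + g' v) x"
proof (rule strictly_differentiableI)
  show "bounded_linear (\<lambda>v. f' v + g' v)"
    using f g by (simp add: strictly_differentiable_def bounded_linear_add)
  fix e :: real assume "e > 0"
  then have "e/2 > 0" by simp
  obtain d1 where d1: "d1 > 0" "\<And>y z. y \<in> ball x d1 \<Longrightarrow> z \<in> ball x d1 \<Longrightarrow>
      norm (f y - f z - f' (y - z)) \<le> e/2 * norm (y - z)"
    using strictly_differentiableD[OF f \<open>e/2 > 0\<close>] by metis
  obtain d2 where d2: "d2 > 0" "\<And>y z. y \<in> ball x d2 \<Longrightarrow> z \<in> ball x d2 \<Longrightarrow>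
      norm (g y - g z - g' (y - z)) \<le> e/2 * norm (y - z)"
    using strictly_differentiableD[OF g \<open>e/2 > 0\<close>] by metis
  have "norm (f y + g y - (f z + g z) - (f' (y - z) + g' (y - z))) \<le> e * norm (y - z)"
    if yz: "y \<in> ball x (min d1 d2)" "z \<in> ball x (min d1 d2)" for y z
  proof -
    have "norm ((f y - f z - f' (y - z)) + (g y - g z - g' (y - z))) \<le> e/2 * norm (y - z) + e/2 * norm (y - z)"
      using yz by (intro norm_triangle_mono d1 d2) auto
    then show ?thesis by (simp add: algebra_simps)
  qed
  moreover have "min d1 d2 > 0" using d1 d2 by simp
  ultimately show "\<exists>d>0. \<forall>y\<in>ball x d. \<forall>z\<in>ball x d.
      norm (f y + g y - (f z + g z) - (f' (y - z) + g' (y - z))) \<le> e * norm (y - z)"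
    by blast
qed

lemma strictly_differentiable_bounded_linear_compose:
  assumes f: "strictly_differentiable f f' x" and h: "bounded_linear h"
  shows "strictly_differentiable (\<lambda>y. h (f y)) (\<lambda>v. h (f' v)) x"
proof (rule strictly_differentiableI)
  show "bounded_linear (\<lambda>v. h (f' v))"
    using f h by (simp add: strictly_differentiable_def bounded_linear_compose)
  fix e :: real assume "e > 0"
  obtain K where K: "K > 0" "\<And>v. norm (h v) \<le> norm v * K"
    using bounded_linear.pos_bounded[OF h] by blast
  have "e / K > 0" using K \<open>e > 0\<close> by simp
  obtain d where d: "d > 0" "\<And>y z. y \<in> ball x d \<Longrightarrow> z \<in> ball x d \<Longrightarrow>
      norm (f y - f z - f' (y - z)) \<le> e / K * norm (y - z)"
    using strictly_differentiableD[OF f \<open>e / K > 0\<close>] by metis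
  have "norm (h (f y) - h (f z) - h (f' (y - z))) \<le> e * norm (y - z)"
    if yz: "y \<in> ball x d" "z \<in> ball x d" for y z
  proof -
    have "norm (h (f y) - h (f z) - h (f' (y - z))) = norm (h (f y - f z - f' (y - z)))"
      using h by (simp add: bounded_linear.linear linear_diff)
    also have "\<dots> \<le> norm (f y - f z - f' (y - z)) * K" by (rule K)
    also have "\<dots> \<le> e / K * norm (y - z) * K"
      using K d(2)[OF yz] by (intro mult_right_mono) auto
    finally show ?thesis using K by simp
  qed
  then show "\<exists>d>0. \<forall>y\<in>ball x d. \<forall>z\<in>ball x d.
      norm (h (f y) - h (f z) - h (f' (y - z))) \<le> e * norm (y - z)"
    using d(1) by blast
qed

lemma strictly_differentiable_sum:
  assumes "\<And>i. i \<in> I \<Longrightarrow> strictly_differentiable (f i) (f' i) x"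
  shows "strictly_differentiable (\<lambda>y. \<Sum>i\<in>I. f i y) (\<lambda>v. \<Sum>i\<in>I. f' i v) x"
  using assms
proof (induction I rule: infinite_finite_induct)
  case (insert i I)
  then show ?case by (simp add: strictly_differentiable_add)
qed (simp_all add: strictly_differentiable_const)

lemma strictly_differentiable_mult:
  fixes f g :: "'a::real_normed_vector \<Rightarrow> real"
  assumes f: "strictly_differentiable f f' x" and g: "strictly_differentiable g g' x"
  shows "strictly_differentiable (\<lambda>y. f y * g y) (\<lambda>v. f x * g' v + f' v * g x) x"
proof (rule strictly_differentiableI)
  show "bounded_linear (\<lambda>v. f x * g' v + f' v * g x)"
    using f g unfolding strictly_differentiable_def
    by (intro bounded_linear_add bounded_linear_const_mult bounded_linear_mult_const) auto
  have g': "bounded_linear g'" using g by (simp add: strictly_differentiable_def)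
  obtain K where K: "K \<ge> 0" "\<And>v. norm (g' v) \<le> norm v * K"
    using bounded_linear.nonneg_bounded[OF g'] by blast
  obtain df Lf where df: "df > 0" "Lf-lipschitz_on (ball x df) f"
    using strictly_differentiable_imp_lipschitz[OF f] .
  have cf: "isCont f x" and cg: "isCont g x"
    using f g strictly_differentiable_imp_has_derivative has_derivative_continuous by blast+
  fix e :: real assume e: "e > 0"
  \<comment> \<open>The coefficients of \<open>\<eta> * norm (y - z)\<close> in the five-term
    estimate at the end, added up; the summand 1 comes from the product \<open>p * q\<close> with
    \<open>\<bar>p\<bar> \<le> 1\<close>.\<close>
  define M where "M = 1 + Lf + \<bar>f x\<bar> + \<bar>g x\<bar> + K"
  have "Lf \<ge> 0" using df(2) by (rule lipschitz_on_nonneg)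
  have "M \<ge> 1" using \<open>Lf \<ge> 0\<close> K(1) by (simp add: M_def)
  define \<eta> where "\<eta> = min 1 (e / (4 * M))"
  have \<eta>: "\<eta> > 0" "\<eta> \<le> 1" "4 * (M * \<eta>) \<le> e"
    using \<open>M \<ge> 1\<close> \<open>e > 0\<close> by (auto simp: \<eta>_def min_def field_simps)
  obtain d1 where d1: "d1 > 0" "\<And>y z. y \<in> ball x d1 \<Longrightarrow> z \<in> ball x d1 \<Longrightarrow>
      norm (f y - f z - f' (y - z)) \<le> \<eta> * norm (y - z)"
    using strictly_differentiableD[OF f \<eta>(1)] by metis
  obtain d2 where d2: "d2 > 0" "\<And>y z. y \<in> ball x d2 \<Longrightarrow> z \<in> ball x d2 \<Longrightarrow>
      norm (g y - g z - g' (y - z)) \<le> \<eta> * norm (y - z)"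
    using strictly_differentiableD[OF g \<eta>(1)] by metis
  obtain d3 where d3: "d3 > 0" "\<And>y. dist y x < d3 \<Longrightarrow> dist (f y) (f x) < \<eta>"
    using cf \<eta>(1) unfolding continuous_at_eps_delta by blast
  obtain d4 where d4: "d4 > 0" "\<And>y. dist y x < d4 \<Longrightarrow> dist (g y) (g x) < \<eta>"
    using cg \<eta>(1) unfolding continuous_at_eps_delta by blast
  define d where "d = min df (min (min d1 d2) (min d3 d4))"
  have "d > 0" using df d1 d2 d3 d4 by (simp add: d_def)
  have "norm (f y * g y - f z * g z - (f x * g' (y - z) + f' (y - z) * g x)) \<le> e * norm (y - z)"
    if yz: "y \<in> ball x d" "z \<in> ball x d" for y z
  proof -
    define n where "n = norm (y - z)"
    have "n \<ge> 0" by (simp add: n_def)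
    have 1: "\<bar>f y - f z - f' (y - z)\<bar> \<le> \<eta> * n"
      using d1(2)[of y z] yz by (simp add: d_def n_def)
    have 2: "\<bar>g y - g z - g' (y - z)\<bar> \<le> \<eta> * n"
      using d2(2)[of y z] yz by (simp add: d_def n_def)
    have 3: "\<bar>f y - f x\<bar> \<le> \<eta>"
      using d3(2)[of y] yz by (simp add: d_def dist_commute dist_real_def less_imp_le)
    have 4: "\<bar>g z - g x\<bar> \<le> \<eta>"
      using d4(2)[of z] yz by (simp add: d_def dist_commute dist_real_def less_imp_le)
    have 5: "\<bar>f y - f z\<bar> \<le> Lf * n"
      using lipschitz_onD[OF df(2), of y z] yz by (simp add: d_def n_def dist_norm)
    have 6: "\<bar>g' (y - z)\<bar> \<le> n * K" using K(2)[of "y - z"] by (simp add: n_def)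
    define p q r s u w where "p = f y - f x" and "q = g y - g z - g' (y - z)" and "r = g' (y - z)"
      and "s = f y - f z" and "u = g z - g x" and "w = f y - f z - f' (y - z)"
    note defs = this
    have bounds: "\<bar>p\<bar> \<le> \<eta>" "\<bar>p\<bar> \<le> 1" "\<bar>q\<bar> \<le> \<eta> * n" "\<bar>r\<bar> \<le> n * K" "\<bar>s\<bar> \<le> Lf * n" "\<bar>u\<bar> \<le> \<eta>"
      "\<bar>w\<bar> \<le> \<eta> * n"
      using 1 2 3 4 5 6 \<eta>(2) by (simp_all add: defs)
    \<comment> \<open>The remainder in the Leibniz rule is split so that every term has one factor
      of order \<open>norm (y - z)\<close> and a gain of \<open>\<eta>\<close>, either from
      continuity (\<open>p\<close>, \<open>u\<close>) or from strict differentiability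
      (\<open>q\<close>, \<open>w\<close>).\<close>
    have eq: "f y * g y - f z * g z - (f x * g' (y - z) + f' (y - z) * g x)
        = p * q + f x * q + p * r + s * u + w * g x"
      by (simp add: defs algebra_simps)
    have "\<bar>p * q + f x * q + p * r + s * u + w * g x\<bar>
        \<le> \<bar>p * q\<bar> + \<bar>f x * q\<bar> + \<bar>p * r\<bar> + \<bar>s * u\<bar> + \<bar>w * g x\<bar>"
      by (intro order_trans[OF abs_triangle_ineq] add_mono) simp_all
    also have "\<dots> \<le> 1 * (\<eta> * n) + \<bar>f x\<bar> * (\<eta> * n) + \<eta> * (n * K) + (Lf * n) * \<eta> + (\<eta> * n) * \<bar>g x\<bar>"
      unfolding abs_mult using bounds \<eta>(1) \<open>n \<ge> 0\<close> \<open>Lf \<ge> 0\<close>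
      by (intro add_mono mult_mono) simp_all
    also have "\<dots> = M * \<eta> * n" by (simp add: M_def algebra_simps)
    also have "\<dots> \<le> e * n"
      using \<eta>(3) \<open>n \<ge> 0\<close> \<open>e > 0\<close> by (intro mult_right_mono) auto
    finally show ?thesis unfolding eq by (simp add: n_def)
  qed
  then show "\<exists>d>0. \<forall>y\<in>ball x d. \<forall>z\<in>ball x d.
      norm (f y * g y - f z * g z - (f x * g' (y - z) + f' (y - z) * g x)) \<le> e * norm (y - z)"
    using \<open>d > 0\<close> by blast
qed

lemma strictly_differentiable_prod:
  fixes f :: "'i \<Rightarrow> 'a::real_normed_vector \<Rightarrow> real"
  assumes "\<And>i. i \<in> I \<Longrightarrow> \<exists>f'. strictly_differentiable (f i) f' x"
  shows "\<exists>p'. strictly_differentiable (\<lambda>y. \<Prod>i\<in>I. f i y) p' x"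
  using assms
proof (induction I rule: infinite_finite_induct)
  case (insert i I)
  then obtain p' f' where "strictly_differentiable (\<lambda>y. \<Prod>i\<in>I. f i y) p' x"
      "strictly_differentiable (f i) f' x" by blast
  with insert(1,2) show ?case by (auto dest: strictly_differentiable_mult)
qed (auto intro: strictly_differentiable_const)

text \<open>The determinant is a polynomial in the entries. Existence of some strict derivative is
  enough, because it must coincide with the Frechet derivative that occurs in the fold
  condition.\<close>

lemma strictly_differentiable_det:
  fixes M :: "'a::real_normed_vector \<Rightarrow> real^'d^'d"
  assumes "\<And>i j. \<exists>f'. strictly_differentiable (\<lambda>y. M y $ i $ j) f' x"
  shows "\<exists>f'. strictly_differentiable (\<lambda>y. det (M y)) f' x"
proof -
  have "\<exists>f'. strictly_differentiable (\<lambda>y. of_int (sign p) * (\<Prod>i\<in>UNIV. M y $ i $ p i)) f' x" for p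
  proof -
    obtain f' where "strictly_differentiable (\<lambda>y. \<Prod>i\<in>UNIV. M y $ i $ p i) f' x"
      using strictly_differentiable_prod[of UNIV "\<lambda>i y. M y $ i $ p i"] assms by blast
    then show ?thesis
      using strictly_differentiable_bounded_linear_compose bounded_linear_mult_right by blast
  qed
  then have "\<forall>p. \<exists>f'. strictly_differentiable (\<lambda>y. of_int (sign p) * (\<Prod>i\<in>UNIV. M y $ i $ p i)) f' x" ..
  from choice[OF this]
  obtain f' where "\<forall>p. strictly_differentiable (\<lambda>y. of_int (sign p) * (\<Prod>i\<in>UNIV. M y $ i $ p i)) (f' p) x"
    by (rule exE)
  then have "strictly_differentiable (\<lambda>y. det (M y)) (\<lambda>v. \<Sum>p | p permutes UNIV. f' p v) x"
    unfolding det_def by (intro strictly_differentiable_sum) (erule spec)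
  then show ?thesis by (rule exI[where x = "\<lambda>v. \<Sum>p | p permutes UNIV. f' p v"])
qed

lemma strictly_differentiable_vec:
  fixes f :: "'a::real_normed_vector \<Rightarrow> real^'d"
  assumes "\<And>j. strictly_differentiable (\<lambda>y. f y $ j) (f' j) x"
  shows "strictly_differentiable f (\<lambda>v. \<chi> j. f' j v) x"
proof -
  have expand: "(\<Sum>j\<in>UNIV. w j *\<^sub>R axis j 1) = (\<chi> j. w j)" for w :: "'d \<Rightarrow> real"
    using basis_expansion[of "\<chi> j. w j"] by (simp add: scalar_mult_eq_scaleR)
  have "strictly_differentiable (\<lambda>y. \<Sum>j\<in>UNIV. (f y $ j) *\<^sub>R axis j (1::real))
      (\<lambda>v. \<Sum>j\<in>UNIV. f' j v *\<^sub>R axis j 1) x"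
    by (intro strictly_differentiable_sum
        strictly_differentiable_bounded_linear_compose[OF assms] bounded_linear_scaleR_left)
  then show ?thesis unfolding expand by simp
qed

lemma strictly_differentiable_Pair:
  assumes f: "strictly_differentiable f f' x" and g: "strictly_differentiable g g' x"
  shows "strictly_differentiable (\<lambda>y. (f y, g y)) (\<lambda>v. (f' v, g' v)) x"
proof -
  have "strictly_differentiable (\<lambda>y. (f y, 0) + (0, g y)) (\<lambda>v. (f' v, 0) + (0, g' v)) x"
    using strictly_differentiable_bounded_linear_compose[OF f, of "\<lambda>a. (a, 0)"]
      strictly_differentiable_bounded_linear_compose[OF g, of "\<lambda>a. (0, a)"]
    by (intro strictly_differentiable_add)
      (simp_all add: bounded_linear_Pair bounded_linear_ident bounded_linear_zero)
  then show ?thesis by simp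
qed

text \<open>The embedding of \<open>y\<close> as \<open>(a, y)\<close> is isometric and maps the
  ball around \<open>x\<close> into the ball around \<open>(a, x)\<close>. This passes from joint
  regularity in parameter and point to regularity in the point alone.\<close>

lemma strictly_differentiable_slice:
  assumes "strictly_differentiable f f' (a, x)"
  shows "strictly_differentiable (\<lambda>y. f (a, y)) (\<lambda>v. f' (0, v)) x"
proof (rule strictly_differentiableI)
  have "bounded_linear f'" using assms by (simp add: strictly_differentiable_def)
  then show "bounded_linear (\<lambda>v. f' (0, v))"
    by (rule bounded_linear_compose)
      (simp add: bounded_linear_Pair bounded_linear_ident bounded_linear_zero)
  fix e :: real assume "e > 0"
  then obtain d where d: "d > 0" "\<And>y z. y \<in> ball (a, x) d \<Longrightarrow> z \<in> ball (a, x) d \<Longrightarrow>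
      norm (f y - f z - f' (y - z)) \<le> e * norm (y - z)"
    using strictly_differentiableD[OF assms] by metis
  have "norm (f (a, y) - f (a, z) - f' (0, y - z)) \<le> e * norm (y - z)"
    if "y \<in> ball x d" "z \<in> ball x d" for y z
    using d(2)[of "(a, y)" "(a, z)"] that by (simp add: dist_Pair_Pair norm_Pair)
  then show "\<exists>d>0. \<forall>y\<in>ball x d. \<forall>z\<in>ball x d.
      norm (f (a, y) - f (a, z) - f' (0, y - z)) \<le> e * norm (y - z)"
    using d(1) by blast
qed

subsection \<open>Fold maps\<close>

text \<open>At a fold point, a vector killed by both \<open>H'\<close> and \<open>J'\<close>
  contradicts the fold condition unless it is zero, so the pair of derivatives is injective. Asking
  \<open>y\<close> and \<open>z\<close> to be of the same type as \<open>x\<close> makes the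
  determinants vanish at both points in the critical case, and lets both cases share one
  conclusion.\<close>

lemma fold_map_locally_expanding:
  fixes H :: "real^'d \<Rightarrow> real^'d"
  assumes H: "strictly_differentiable H H' x"
    and J: "strictly_differentiable (jacobian_det H) J' x"
    and fold: "x \<in> critical_points H \<Longrightarrow> fold_nondegenerate_at H x"
  obtains d c where "d > 0" "c > 0"
    "\<And>y z. \<lbrakk>y \<in> ball x d; z \<in> ball x d; (y \<in> critical_points H) = (x \<in> critical_points H);
      (z \<in> critical_points H) = (x \<in> critical_points H)\<rbrakk> \<Longrightarrow> c * dist y z \<le> dist (H y) (H z)"
proof -
  have H'd: "(H has_derivative H') (at x)"
    using H by (rule strictly_differentiable_imp_has_derivative)
  then have "frechet_derivative H (at x) = H'"
    by (rule frechet_derivative_at[symmetric])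
  have lin: "linear H'" using H'd has_derivative_linear by blast
  have DM: "derivative_matrix H x *v v = H' v" for v
    unfolding derivative_matrix_def \<open>frechet_derivative H (at x) = H'\<close> using lin by (simp add: matrix_works)
  have crit: "jacobian_det H y = 0" if "y \<in> critical_points H" for y
  proof -
    \<comment> \<open>The truncated subtraction in \<open>CARD('d) - 1\<close> is harmless, since
      \<open>CARD('d)\<close> is positive.\<close>
    have "rank (derivative_matrix H y) < CARD('d)"
      using that by (simp add: critical_points_def le_less_trans)
    then have "\<not> inj ((*v) (derivative_matrix H y))"
      by (simp add: less_rank_noninjective)
    then show ?thesis
      using det_nz_iff_inj[OF matrix_vector_mul_linear, of "derivative_matrix H y"]
      by (simp add: jacobian_det_def matrix_of_matrix_vector_mul)
  qed
  show thesis
  proof (cases "x \<in> critical_points H")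
    case False
    then have "\<not> rank (derivative_matrix H x) < CARD('d)"
      by (simp add: critical_points_def)
    then have "inj ((*v) (derivative_matrix H x))"
      by (simp add: less_rank_noninjective)
    moreover have "(*v) (derivative_matrix H x) = H'" by (rule ext) (rule DM)
    ultimately have "inj H'" by simp
    from strictly_differentiable_injective_imp_expanding[OF H this]
    show thesis using that by metis
  next
    case True
    have J'd: "frechet_derivative (jacobian_det H) (at x) = J'"
      using strictly_differentiable_imp_has_derivative[OF J] by (rule frechet_derivative_at[symmetric])
    have HJ: "strictly_differentiable (\<lambda>y. (H y, jacobian_det H y)) (\<lambda>v. (H' v, J' v)) x"
      using H J by (rule strictly_differentiable_Pair)
    have "linear (\<lambda>v. (H' v, J' v))"
      using HJ by (simp add: strictly_differentiable_def bounded_linear.linear)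
    moreover have "v = 0" if "(H' v, J' v) = 0" for v
      using fold[OF True] that unfolding fold_nondegenerate_at_def DM J'd by (auto simp: zero_prod_def)
    ultimately have "inj (\<lambda>v. (H' v, J' v))"
      by (simp add: linear_injective_0)
    from strictly_differentiable_injective_imp_expanding[OF HJ this]
    obtain d c where "d > 0" "c > 0" and dc: "\<And>y z. y \<in> ball x d \<Longrightarrow> z \<in> ball x d \<Longrightarrow>
        c * dist y z \<le> dist (H y, jacobian_det H y) (H z, jacobian_det H z)"
      by metis
    show thesis
    proof
      fix y z
      assume "y \<in> ball x d" "z \<in> ball x d" "(y \<in> critical_points H) = (x \<in> critical_points H)"
        "(z \<in> critical_points H) = (x \<in> critical_points H)"
      then show "c * dist y z \<le> dist (H y) (H z)"
        using dc[of y z] True by (simp add: crit dist_Pair_Pair)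
    qed fact+
  qed
qed

text \<open>Joint C2 regularity is used at two levels: the function is C1, which settles the
  encoding map, and its derivative is C1, which settles the entries of the derivative matrix and
  hence their determinant.\<close>

lemma encoding_map_strictly_differentiable:
  fixes \<phi> :: "real^'m \<Rightarrow> real^'d \<Rightarrow> real"
  assumes "open A" and C2: "C2_on (A \<times> UNIV) (\<lambda>(\<alpha>, x). \<phi> \<alpha> x)" and \<beta>: "\<And>j. \<beta> $ j \<in> A"
  shows "\<exists>H'. strictly_differentiable (encoding_map \<phi> \<beta>) H' x"
    and "\<exists>J'. strictly_differentiable (jacobian_det (encoding_map \<phi> \<beta>)) J' x"
proof -
  let ?S = "A \<times> (UNIV :: (real^'d) set)" and ?f = "\<lambda>(\<alpha>, x). \<phi> \<alpha> x"
  obtain f' f'' where f': "\<And>z. z \<in> ?S \<Longrightarrow> (?f has_derivative blinfun_apply (f' z)) (at z)"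
    and f'': "\<And>z. z \<in> ?S \<Longrightarrow> (f' has_derivative blinfun_apply (f'' z)) (at z)"
    and cont: "continuous_on ?S f''"
    using C2 unfolding C2_on_def by blast
  have S: "open ?S" using \<open>open A\<close> by (simp add: open_Times)
  have mem: "(\<beta> $ j, y) \<in> ?S" for j y using \<beta> by simp
  have "isCont f' z" if "z \<in> ?S" for z
    using f''[OF that] has_derivative_continuous by blast
  then have sf: "strictly_differentiable ?f (blinfun_apply (f' z)) z" if "z \<in> ?S" for z
    using C1_imp_strictly_differentiable[OF S that f'] that by blast
  have sf': "strictly_differentiable f' (blinfun_apply (f'' z)) z" if "z \<in> ?S" for z
    using C1_imp_strictly_differentiable[OF S that f''] cont S that
    by (metis continuous_on_eq_continuous_at)
  have H: "strictly_differentiable (encoding_map \<phi> \<beta>) (\<lambda>v. \<chi> j. f' (\<beta> $ j, y) (0, v)) y" for y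
  proof (rule strictly_differentiable_vec)
    show "strictly_differentiable (\<lambda>y. encoding_map \<phi> \<beta> y $ j) (\<lambda>v. f' (\<beta> $ j, y) (0, v)) y" for j
      using strictly_differentiable_slice[OF sf[OF mem], of j y] by (simp add: encoding_map_def)
  qed
  then show "\<exists>H'. strictly_differentiable (encoding_map \<phi> \<beta>) H' x" by blast
  have fd: "frechet_derivative (encoding_map \<phi> \<beta>) (at y) = (\<lambda>v. \<chi> j. f' (\<beta> $ j, y) (0, v))" for y
    using strictly_differentiable_imp_has_derivative[OF H] by (rule frechet_derivative_at[symmetric])
  \<comment> \<open>Each entry is a fixed bounded linear functional, evaluation at
    \<open>(0, axis j 1)\<close>, of the operator \<open>f' (\<beta> $ i, y)\<close>, so it inherits
    strict differentiability from \<open>f'\<close>.\<close>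
  have entry: "derivative_matrix (encoding_map \<phi> \<beta>) y $ i $ j = f' (\<beta> $ i, y) (0, axis j 1)" for y i j
    by (simp add: derivative_matrix_def matrix_def fd)
  have "\<exists>g'. strictly_differentiable (\<lambda>y. derivative_matrix (encoding_map \<phi> \<beta>) y $ i $ j) g' x" for i j
    unfolding entry
    using strictly_differentiable_bounded_linear_compose[OF
        strictly_differentiable_slice[OF sf'[OF mem]] blinfun.bounded_linear_left]
    by blast
  then show "\<exists>J'. strictly_differentiable (jacobian_det (encoding_map \<phi> \<beta>)) J' x"
    unfolding jacobian_det_def[abs_def] by (rule strictly_differentiable_det)
qed

text \<open>Along each curve \<open>f i\<close>, locally in the parameter,
  \<open>H \<circ> f i\<close> is Lipschitz with null coordinate images, so the image of the piece
  under \<open>H\<close> is null. Local expansion of \<open>H\<close> then makes the piece itself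
  null.\<close>

lemma rectifiable_null_of_null_coordinates:
  fixes H :: "real^'d \<Rightarrow> real^'d"
  assumes H: "\<And>x. \<exists>H'. strictly_differentiable H H' x"
    and J: "\<And>x. \<exists>J'. strictly_differentiable (jacobian_det H) J' x"
    and fold: "\<And>x. x \<in> critical_points H \<Longrightarrow> fold_nondegenerate_at H x"
    and E: "rectifiable_1 E"
    and null: "\<And>j. negligible ((\<lambda>x. H x $ j) ` E)"
  shows "hausdorff_1 E = 0"
proof -
  obtain f :: "nat \<Rightarrow> real \<Rightarrow> real^'d" where f: "\<And>i. \<exists>L. L-lipschitz_on UNIV (f i)"
    and rest: "hausdorff_1 (E - (\<Union>i. range (f i))) = 0"
    using E unfolding rectifiable_1_def by blast
  \<comment> \<open>The flag \<open>b\<close> separates critical from regular points, because the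
    expansion estimate compares only points of the same type as the centre.\<close>
  have piece: "hausdorff_1 (f i ` {t. f i t \<in> E \<and> (f i t \<in> critical_points H) = b}) = 0" for i b
  proof (rule hausdorff_1_locally_null)
    let ?S = "{t. f i t \<in> E \<and> (f i t \<in> critical_points H) = b}"
    fix t assume t: "t \<in> ?S"
    obtain K where K: "K-lipschitz_on UNIV (f i)" using f by blast
    obtain H' J' where H': "strictly_differentiable H H' (f i t)"
      and J': "strictly_differentiable (jacobian_det H) J' (f i t)"
      using H J by blast
    obtain d c where dc: "d > 0" "c > 0" "\<And>y z. \<lbrakk>y \<in> ball (f i t) d; z \<in> ball (f i t) d;
        (y \<in> critical_points H) = (f i t \<in> critical_points H);
        (z \<in> critical_points H) = (f i t \<in> critical_points H)\<rbrakk> \<Longrightarrow> c * dist y z \<le> dist (H y) (H z)"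
      using fold_map_locally_expanding[OF H' J' fold] by metis
    obtain r L where rL: "r > 0" "L-lipschitz_on (ball (f i t) r) H"
      using strictly_differentiable_imp_lipschitz[OF H'] .
    \<comment> \<open>Radius \<open>d\<close> ensures expansion of \<open>H\<close> and radius
      \<open>r\<close> its Lipschitz bound.\<close>
    define W where "W = f i -` ball (f i t) (min d r)"
    have "open W"
      unfolding W_def using lipschitz_on_continuous_on[OF K] by (intro open_vimage) auto
    have "(L * K)-lipschitz_on W (H \<circ> f i)"
      by (rule lipschitz_on_compose[OF lipschitz_on_subset[OF K] lipschitz_on_subset[OF rL(2)]])
        (auto simp: W_def)
    then have "hausdorff_1 ((H \<circ> f i) ` (?S \<inter> W)) = 0"
    proof (rule lipschitz_curve_null_of_null_coordinates[OF \<open>open W\<close>])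
      show "negligible ((\<lambda>s. (H \<circ> f i) s $ j) ` (?S \<inter> W))" for j
        using null[of j] by (rule negligible_subset) auto
    qed blast
    then have "hausdorff_1 (H ` (f i ` (?S \<inter> W))) = 0" by (simp add: image_comp)
    then have "hausdorff_1 (f i ` (?S \<inter> W)) = 0"
      by (rule hausdorff_1_null_of_expanding_image[OF dc(2), rotated])
        (use dc(3) t in \<open>auto simp: W_def\<close>)
    moreover have "t \<in> W" using dc(1) rL(1) by (simp add: W_def)
    ultimately show "\<exists>W. open W \<and> t \<in> W \<and> hausdorff_1 (f i ` (?S \<inter> W)) = 0"
      using \<open>open W\<close> by blast
  qed
  have "hausdorff_1 (\<Union>i. f i ` {t. f i t \<in> E \<and> (f i t \<in> critical_points H) = True}
      \<union> f i ` {t. f i t \<in> E \<and> (f i t \<in> critical_points H) = False}) = 0"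
    by (intro hausdorff_1_UN_null hausdorff_1_Un_null piece)
  from hausdorff_1_Un_null[OF rest this] show ?thesis
    by (rule hausdorff_1_mono_null) blast
qed

theorem corollary4p12:
  fixes \<alpha>\<^sub>0 :: "(real^'m)^'d"
    and A :: "(real^'m) set"
    and V :: "((real^'m)^'d) set"
  assumes "CARD('d) \<ge> 2"
    and "open A"
    and "open V" and "\<alpha>\<^sub>0 \<in> V" and "V \<subseteq> {\<beta>. \<forall>j. \<beta> $ j \<in> A}"
  shows "\<exists>U :: 'd \<Rightarrow> (real^'m) set.
    (\<forall>j. open (U j) \<and> \<alpha>\<^sub>0 $ j \<in> U j \<and> U j \<subseteq> A) \<and>
    (\<forall>\<phi> :: real^'m \<Rightarrow> real^'d \<Rightarrow> real.
       C2_on (A \<times> UNIV) (\<lambda>(\<alpha>, x). \<phi> \<alpha> x) \<longrightarrow>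
       (\<forall>\<beta>\<in>V. \<forall>x\<in>critical_points (encoding_map \<phi> \<beta>).
          fold_nondegenerate_at (encoding_map \<phi> \<beta>) x) \<longrightarrow>
       (\<forall>E :: (real^'d) set. rectifiable_1 E \<and> hausdorff_1 E > 0 \<longrightarrow>
          (\<exists>j. \<forall>\<alpha>\<in>U j. hausdorff_1 (\<phi> \<alpha> ` E) > 0)))"
proof -
  \<comment> \<open>Openness in the finite product supplies an open box around
    \<open>\<alpha>\<^sub>0\<close> inside \<open>V\<close>. It is fixed before
    \<open>\<phi>\<close> and \<open>E\<close> appear, so the neighbourhoods do not depend on
    them.\<close>
  from bspec[OF iffD1[OF open_vec_def assms(3)] assms(4)]
  obtain B where "(\<forall>i. open (B i) \<and> \<alpha>\<^sub>0 $ i \<in> B i) \<and> (\<forall>\<beta>. (\<forall>i. \<beta> $ i \<in> B i) \<longrightarrow> \<beta> \<in> V)"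
    by (rule exE)
  then have B: "\<And>j. open (B j)" "\<And>j. \<alpha>\<^sub>0 $ j \<in> B j" "\<And>\<beta>. (\<And>j. \<beta> $ j \<in> B j) \<Longrightarrow> \<beta> \<in> V"
    by simp_all
  show ?thesis
  proof (intro exI[of _ "\<lambda>j. B j \<inter> A"] conjI allI impI)
    show "open (B j \<inter> A)" "\<alpha>\<^sub>0 $ j \<in> B j \<inter> A" "B j \<inter> A \<subseteq> A" for j
      using B(1,2) assms(2) subsetD[OF assms(5,4)] by (simp_all add: open_Int)
  next
    fix \<phi> :: "real^'m \<Rightarrow> real^'d \<Rightarrow> real" and E :: "(real^'d) set"
    assume C2: "C2_on (A \<times> UNIV) (\<lambda>(\<alpha>, x). \<phi> \<alpha> x)"
      and fold: "\<forall>\<beta>\<in>V. \<forall>x\<in>critical_points (encoding_map \<phi> \<beta>). fold_nondegenerate_at (encoding_map \<phi> \<beta>) x"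
      and E: "rectifiable_1 E \<and> hausdorff_1 E > 0"
    show "\<exists>j. \<forall>\<alpha>\<in>B j \<inter> A. hausdorff_1 (\<phi> \<alpha> ` E) > 0"
    proof (rule ccontr)
      assume "\<not> ?thesis"
      then have "\<forall>j. \<exists>\<alpha>. \<alpha> \<in> B j \<inter> A \<and> hausdorff_1 (\<phi> \<alpha> ` E) = 0"
        by (auto simp: zero_less_iff_neq_zero)
      \<comment> \<open>The bad parameters are chosen independently for each coordinate; the box
        structure guarantees that the tuple assembled from them still lies in \<open>V\<close>,
        where the fold hypothesis applies.\<close>
      from choice[OF this] obtain b where b: "\<And>j. b j \<in> B j \<inter> A" "\<And>j. hausdorff_1 (\<phi> (b j) ` E) = 0"
        by blast
      define \<beta> where "\<beta> = (\<chi> j. b j)"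
      have "\<beta> \<in> V" and \<beta>A: "\<And>j. \<beta> $ j \<in> A" using b(1) B(3)[of \<beta>] by (auto simp: \<beta>_def)
      have "hausdorff_1 E = 0"
      proof (rule rectifiable_null_of_null_coordinates[of "encoding_map \<phi> \<beta>"])
        show "\<exists>H'. strictly_differentiable (encoding_map \<phi> \<beta>) H' x"
          and "\<exists>J'. strictly_differentiable (jacobian_det (encoding_map \<phi> \<beta>)) J' x" for x
          using encoding_map_strictly_differentiable[OF assms(2) C2 \<beta>A] by blast+
        show "fold_nondegenerate_at (encoding_map \<phi> \<beta>) x"
          if "x \<in> critical_points (encoding_map \<phi> \<beta>)" for x
          using fold \<open>\<beta> \<in> V\<close> that by blast
        show "negligible ((\<lambda>x. encoding_map \<phi> \<beta> x $ j) ` E)" for j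
          using hausdorff_1_null_imp_negligible[OF b(2)] by (simp add: encoding_map_def \<beta>_def)
      qed (use E in blast)
      with E show False by simp
    qed
  qed
qed

end
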